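(* Let $R$ be a ring with $\alpha(G(R)) < \infty$. Then $R$ is finite or $R$ is a division ring.
   Context: Rings are associative, not necessarily commutative, with identity $1 \neq 0$. The unit graph $G(R)$ is the simple graph whose vertices are the elements of $R$, where two distinct vertices $a, b$ are adjacent if and only if $a+b$ is a unit of $R$. The independence number $\alpha(G)$ of a graph $G$ is the size of a largest independent set (set of pairwise non-adjacent vertices) of $G$; $\alpha(G)<\infty$ means that the sizes of independent sets of $G$ are bounded by a natural number. *)

theory Defs
  imports "HOL-Algebra.Ring" "HOL-Library.Ramsey" "HOL-Library.Extended_Nat"
begin

text \<open>
  A simple graph is a pair of a vertex set and a set of edges, where an edge is the
  unordered pair of its two endpoints; this is the edge format that
  \<^const>\<open>indep\<close> expects.
\<close>

type_synonym 'a simple_graph = "'a set \<times> 'a set set"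

definition independent_set :: "'a simple_graph \<Rightarrow> 'a set \<Rightarrow> bool"
  where "independent_set G S \<longleftrightarrow> S \<subseteq> fst G \<and> indep S (snd G)"

text \<open>
  The supremum ranges over finite independent sets only, since \<^const>\<open>card\<close> is 0 on
  infinite sets. No information is lost: subsets of independent sets are independent, so an
  infinite independent set makes the value \<open>\<infinity>\<close>
  (see \<open>independence_number_finite_iff\<close>).
\<close>

definition independence_number :: "'a simple_graph \<Rightarrow> enat"
  where "independence_number G = (SUP S \<in> {S. finite S \<and> independent_set G S}. enat (card S))"

lemma independent_set_subset:
  "independent_set G S \<Longrightarrow> T \<subseteq> S \<Longrightarrow> independent_set G T"
  by (auto simp: independent_set_def indep_def)

lemma independence_number_finite_iff:
  "independence_number G < \<infinity> \<longleftrightarrow>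
     (\<exists>n::nat. \<forall>S. independent_set G S \<longrightarrow> finite S \<and> card S \<le> n)"
proof
  assume "independence_number G < \<infinity>"
  then obtain n where n: "independence_number G = enat n"
    by (auto simp: less_infinityE)
  have bound: "card S \<le> n" if "finite S" "independent_set G S" for S
  proof -
    have "enat (card S) \<le> independence_number G"
      unfolding independence_number_def using that by (intro SUP_upper) auto
    with n show ?thesis by simp
  qed
  have "finite S" if S: "independent_set G S" for S
  proof (rule ccontr)
    assume "infinite S"
    then obtain T where "T \<subseteq> S" "finite T" "card T = Suc n"
      using infinite_arbitrarily_large by blast
    with bound[of T] independent_set_subset[OF S] show False by auto
  qed
  with bound show "\<exists>n::nat. \<forall>S. independent_set G S \<longrightarrow> finite S \<and> card S \<le> n" by blast
next
  assume "\<exists>n::nat. \<forall>S. independent_set G S \<longrightarrow> finite S \<and> card S \<le> n"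
  then obtain n :: nat where "\<forall>S. independent_set G S \<longrightarrow> finite S \<and> card S \<le> n" by blast
  then have "independence_number G \<le> enat n"
    unfolding independence_number_def by (intro SUP_least) auto
  then show "independence_number G < \<infinity>" by (rule le_less_trans) simp
qed

definition unit_graph :: "('a, 'b) ring_scheme \<Rightarrow> 'a simple_graph"
  where "unit_graph R =
    (carrier R,
     {{a, b} | a b. a \<in> carrier R \<and> b \<in> carrier R \<and> a \<noteq> b \<and> a \<oplus>\<^bsub>R\<^esub> b \<in> Units R})"

text \<open>
  The name is shared with the type class of the same name, as for \<^locale>\<open>ring\<close> and
  \<^locale>\<open>field\<close>.
\<close>

locale division_ring = ring +
  assumes one_not_zero: "\<one> \<noteq> \<zero>"
    and division_ring_Units: "Units R = carrier R - {\<zero>}"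

lemma (in ring) unit_graph_adjacent_iff:
  assumes "a \<in> carrier R" "b \<in> carrier R"
  shows "{a, b} \<in> snd (unit_graph R) \<longleftrightarrow> a \<noteq> b \<and> a \<oplus> b \<in> Units R"
  using assms by (auto simp: unit_graph_def doubleton_eq_iff a_comm)

end

theory Submission
  imports Defs
begin

text \<open>
  A set that is closed under addition and contains no unit is independent in the unit graph, hence
  finite. If \<open>a\<close> is nonzero and not left invertible, this applies both to the left ideal \<open>Ra\<close>
  and to the left annihilator of \<open>a\<close>, that is, to the image and the kernel of \<open>r \<mapsto> ra\<close>; so
  the ring is finite. If \<open>a\<close> is not right invertible, use \<open>r \<mapsto> ar\<close> instead.
\<close>

context ring
begin

lemma finite_if_closed_under_add_no_units:
  assumes "independence_number (unit_graph R) < \<infinity>"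
    and "S \<subseteq> carrier R" and "S \<inter> Units R = {}"
    and "\<And>x y. x \<in> S \<Longrightarrow> y \<in> S \<Longrightarrow> x \<oplus> y \<in> S"
  shows "finite S"
proof -
  have "{x, y} \<notin> snd (unit_graph R)" if "x \<in> S" "y \<in> S" for x y
    using that assms(2-4) unit_graph_adjacent_iff[of x y] by blast
  then have "independent_set (unit_graph R) S"
    using assms(2) by (auto simp: independent_set_def indep_def unit_graph_def)
  then show ?thesis
    using assms(1) unfolding independence_number_finite_iff by blast
qed

text \<open>Every nonempty fibre of an additive map is a translate of its kernel, so the carrier is
  a union of finitely many finite fibres.\<close>

lemma finite_carrier_if_finite_kernel_image:
  assumes f: "f \<in> carrier R \<rightarrow> carrier R"
    and add: "\<And>x y. x \<in> carrier R \<Longrightarrow> y \<in> carrier R \<Longrightarrow> f (x \<oplus> y) = f x \<oplus> f y"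
    and ker: "finite {x \<in> carrier R. f x = \<zero>}"
    and img: "finite (f ` carrier R)"
  shows "finite (carrier R)"
proof -
  have "finite {x \<in> carrier R. f x = f y}" if y: "y \<in> carrier R" for y
  proof (rule finite_subset)
    show "{x \<in> carrier R. f x = f y} \<subseteq> (\<lambda>k. k \<oplus> y) ` {x \<in> carrier R. f x = \<zero>}"
    proof
      fix x assume x: "x \<in> {x \<in> carrier R. f x = f y}"
      \<comment> \<open>The difference \<open>x \<ominus> y\<close> is the kernel element whose
        translate by \<open>y\<close> is \<open>x\<close>.\<close>
      have *: "(x \<ominus> y) \<oplus> y = x"
        using x y by (simp add: minus_eq a_assoc l_neg)
      then have "f (x \<ominus> y) \<oplus> f y = f y"
        using add[of "x \<ominus> y" y] x y by simp
      moreover have "f (x \<ominus> y) \<in> carrier R" "f y \<in> carrier R"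
        using f x y by auto
      ultimately have "f (x \<ominus> y) = \<zero>"
        using a_comm add.r_cancel_one' by metis
      then show "x \<in> (\<lambda>k. k \<oplus> y) ` {x \<in> carrier R. f x = \<zero>}"
        using * x y by (intro image_eqI[of _ _ "x \<ominus> y"]) auto
    qed
  qed (use ker in simp)
  then have "finite (\<Union>z\<in>f ` carrier R. {x \<in> carrier R. f x = z})"
    using img by (intro finite_UN_I) auto
  moreover have "carrier R = (\<Union>z\<in>f ` carrier R. {x \<in> carrier R. f x = z})"
    by auto
  ultimately show ?thesis by simp
qed

text \<open>Additivity of \<open>f\<close> makes both its kernel and its image closed under
  addition. Stated for any additive map, so that it serves left and right multiplication
  alike.\<close>

lemma finite_carrier_if_kernel_image_no_units:
  assumes "independence_number (unit_graph R) < \<infinity>"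
    and f: "f \<in> carrier R \<rightarrow> carrier R"
    and add: "\<And>x y. x \<in> carrier R \<Longrightarrow> y \<in> carrier R \<Longrightarrow> f (x \<oplus> y) = f x \<oplus> f y"
    and ker: "\<And>u. u \<in> Units R \<Longrightarrow> f u \<noteq> \<zero>"
    and img: "\<And>x. x \<in> carrier R \<Longrightarrow> f x \<notin> Units R"
  shows "finite (carrier R)"
proof (rule finite_carrier_if_finite_kernel_image[OF f add])
  show "finite {x \<in> carrier R. f x = \<zero>}"
    using ker by (intro finite_if_closed_under_add_no_units[OF assms(1)]) (auto simp: add)
  show "finite (f ` carrier R)"
    using f img by (intro finite_if_closed_under_add_no_units[OF assms(1)])
      (auto simp: add[symmetric])
qed

lemma unit_if_finite_independence_number:
  assumes fin: "independence_number (unit_graph R) < \<infinity>" and inf: "infinite (carrier R)"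
    and a: "a \<in> carrier R" "a \<noteq> \<zero>"
  shows "a \<in> Units R"
proof -
  have "\<exists>x \<in> carrier R. x \<otimes> a \<in> Units R"
  proof (rule ccontr)
    assume "\<not> ?thesis"
    \<comment> \<open>The left annihilator of \<open>a\<close> contains no unit: cancelling
      \<open>u\<close> would give \<open>a = \<zero>\<close>.\<close>
    moreover have "u \<otimes> a \<noteq> \<zero>" if "u \<in> Units R" for u
      using that a Units_l_cancel[OF that a(1) zero_closed] r_null[OF Units_closed[OF that]]
      by simp
    ultimately have "finite (carrier R)"
      using a by (intro finite_carrier_if_kernel_image_no_units[OF fin, of "\<lambda>r. r \<otimes> a"])
        (auto simp: l_distr)
    with inf show False by simp
  qed
  then obtain x where x: "x \<in> carrier R" "x \<otimes> a \<in> Units R" by blast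
  have "\<exists>y \<in> carrier R. a \<otimes> y \<in> Units R"
  proof (rule ccontr)
    assume "\<not> ?thesis"
    \<comment> \<open>Now the unit stands on the right, so it is removed by multiplying with its
      inverse from that side.\<close>
    moreover have "a \<otimes> u \<noteq> \<zero>" if u: "u \<in> Units R" for u
    proof
      assume "a \<otimes> u = \<zero>"
      then have "a \<otimes> u \<otimes> inv u = \<zero>" using u by simp
      moreover have "a \<otimes> u \<otimes> inv u = a"
        using u a m_assoc[OF a(1) Units_closed[OF u] Units_inv_closed[OF u]] by simp
      ultimately show False using a by simp
    qed
    ultimately have "finite (carrier R)"
      using a by (intro finite_carrier_if_kernel_image_no_units[OF fin, of "\<lambda>r. a \<otimes> r"])
        (auto simp: r_distr)
    with inf show False by simp
  qed
  then obtain y where y: "y \<in> carrier R" "a \<otimes> y \<in> Units R" by blast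
  \<comment> \<open>Normalising the two unit multiples of \<open>a\<close> gives a left and a right
    inverse. By associativity they coincide, so \<open>a\<close> has a two-sided inverse.\<close>
  let ?l = "inv (x \<otimes> a) \<otimes> x" and ?r = "y \<otimes> inv (a \<otimes> y)"
  have l: "?l \<otimes> a = \<one>" "?l \<in> carrier R"
    using x a Units_l_inv[of "x \<otimes> a"] by (simp_all add: m_assoc)
  have r: "a \<otimes> ?r = \<one>" "?r \<in> carrier R"
    using y a Units_r_inv[of "a \<otimes> y"] by (simp_all add: m_assoc[symmetric])
  have "?l = ?r"
    using inv_unique[OF l(1) r(1)] l(2) r(2) a(1) by blast
  then show ?thesis
    using l r a unfolding Units_def by auto
qed

end

theorem theorem2p9:
  fixes R (structure)
  assumes "ring R" and "\<one> \<noteq> \<zero>"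
    and "independence_number (unit_graph R) < \<infinity>"
  shows "finite (carrier R) \<or> division_ring R"
proof -
  interpret ring R by fact
  \<comment> \<open>If zero were invertible, then \<open>\<one>\<close> would be a multiple of
    \<open>\<zero>\<close>.\<close>
  have "\<zero> \<notin> Units R"
    using assms(2) by (auto simp: Units_def)
  then have "Units R = carrier R - {\<zero>}" if "infinite (carrier R)"
    using unit_if_finite_independence_number[OF assms(3) that] by blast
  then show ?thesis
    using assms(2) by (auto intro!: division_ring.intro division_ring_axioms.intro ring_axioms)
qed

end
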